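(* Let $X=\bigsqcup_{\lambda\in\Lambda}G_\lambda$ be a multiple group rack and let $Y$ be an $X$-set. Then $(C_n(X)_Y,\partial_n)_{n\in\mathbb{Z}}$ is a chain complex, i.e. $\partial_{n-1}\circ\partial_n=0$ for every $n\in\mathbb{Z}$.
   Context: A multiple group rack (MGR) $X=\bigsqcup_{\lambda\in\Lambda}G_\lambda$ is a disjoint union of groups $G_\lambda$ (identity $e_\lambda$) with a binary operation $*:X^2\to X$ such that: (1) for $x\in X$ and $y_1,y_2\in G_\lambda$, $x*(y_1y_2)=(x*y_1)*y_2$ and $x*e_\lambda=x$; (2) $(x*y)*z=(x*z)*(y*z)$ for all $x,y,z\in X$; (3) for $x_1,x_2\in G_\lambda$ and $y\in X$, the elements $x_1*y,x_2*y$ lie in a common $G_\mu$ and $(x_1x_2)*y=(x_1*y)(x_2*y)$. An $X$-set is a non-empty set $Y$ with a map $\star:Y\times X\to Y$ such that: (1) $\upsilon\star e_\lambda=\upsilon$ and $\upsilon\star(x_1x_2)=(\upsilon\star x_1)\star x_2$ for $\upsilon\in Y$, $x_1,x_2\in G_\lambda$; (2) $(\upsilon\star x)\star y=(\upsilon\star y)\star(x*y)$ for $\upsilon\in Y$, $x,y\in X$. Chain groups. For $n\ge0$, $C_n(X)_Y$ is the free abelian group on the symbols $\langle\upsilon\rangle\langle\boldsymbol{x}_1\rangle\cdots\langle\boldsymbol{x}_k\rangle$, where $k\ge0$, $\upsilon\in Y$, each $\boldsymbol{x}_i=(x_{i,1},\ldots,x_{i,n_i})$ is a sequence of length $n_i\ge1$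 all of whose entries lie in one common group $G_\lambda$ ($\lambda$ may depend on $i$), and $n_1+\cdots+n_k=n$ (ordered decompositions; for $n=0$ the basis is $Y$). For $n<0$, $C_n(X)_Y=0$. For $y\in X$ put $(\langle\upsilon\rangle\langle\boldsymbol{x}_1\rangle\cdots\langle\boldsymbol{x}_k\rangle)*y=\langle\upsilon\star y\rangle\langle\boldsymbol{x}_1*y\rangle\cdots\langle\boldsymbol{x}_k*y\rangle$, where $\boldsymbol{x}*y$ is entrywise. For $\boldsymbol{x}=(x_1,\ldots,x_m)$ put $\boldsymbol{x}^0=(x_2,\ldots,x_m)$, $\boldsymbol{x}^m=(x_1,\ldots,x_{m-1})$, and $\boldsymbol{x}^i=(x_1,\ldots,x_ix_{i+1},\ldots,x_m)$ for $0<i<m$; an empty factor $\langle\ \rangle$ (which occurs when $m=1$) is deleted. Boundary. For $n\le0$, $\partial_n=0$. For $n\ge1$, $\partial_n:C_n(X)_Y\to C_{n-1}(X)_Y$ is the homomorphism with $$\partial_n(\langle\upsilon\rangle\langle\boldsymbol{x}_1\rangle\cdots\langle\boldsymbol{x}_k\rangle)=\sum_{i=1}^k(-1)^{n_1+\cdots+n_{i-1}}\Big[\big((\langle\upsilon\rangle\langle\boldsymbol{x}_1\rangle\cdots\langle\boldsymbol{x}_{i-1}\rangle)*x_{i,1}\big)\langle\boldsymbol{x}_i^0\rangle\langle\boldsymbol{x}_{i+1}\rangle\cdots\langle\boldsymbol{x}_k\rangle+\sum_{j=1}^{n_i}(-1)^j\langle\upsilon\rangle\langle\boldsymbol{x}_1\rangle\cdots\langle\boldsymbol{x}_{i-1}\rangle\langle\boldsymbol{x}_i^j\rangle\langle\boldsymbol{x}_{i+1}\rangle\cdots\langle\boldsymbol{x}_k\rangle\Big].$$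 *)

theory Defs
  imports "HOL-Algebra.Free_Abelian_Groups"
begin

text \<open>The disjoint union of the groups \<open>G l\<close>, \<open>l \<in> L\<close>, is rendered as
  \<open>SIGMA l:L. carrier (G l)\<close>: the element \<open>a\<close> of \<open>G l\<close> is the pair \<open>(l, a)\<close>.
  \<open>mgr_mult G x y\<close> is the product \<open>x y\<close> inside a summand; it is meaningful only if
  \<open>fst x = fst y\<close>.\<close>

definition mgr_carrier :: "'l set \<Rightarrow> ('l \<Rightarrow> ('a, 'm) monoid_scheme) \<Rightarrow> ('l \<times> 'a) set"
  where "mgr_carrier L G = (SIGMA l:L. carrier (G l))"

definition mgr_mult :: "('l \<Rightarrow> ('a, 'm) monoid_scheme) \<Rightarrow> 'l \<times> 'a \<Rightarrow> 'l \<times> 'a \<Rightarrow> 'l \<times> 'a"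
  where "mgr_mult G x y = (fst x, snd x \<otimes>\<^bsub>G (fst x)\<^esub> snd y)"

locale multiple_group_rack =
  fixes L :: "'l set"
    and G :: "'l \<Rightarrow> ('a, 'm) monoid_scheme"
    and rop :: "'l \<times> 'a \<Rightarrow> 'l \<times> 'a \<Rightarrow> 'l \<times> 'a"
  assumes groups: "l \<in> L \<Longrightarrow> group (G l)"
    and rop_closed: "\<lbrakk>x \<in> mgr_carrier L G; y \<in> mgr_carrier L G\<rbrakk> \<Longrightarrow> rop x y \<in> mgr_carrier L G"
    and rop_mult: "\<lbrakk>x \<in> mgr_carrier L G; l \<in> L; a \<in> carrier (G l); b \<in> carrier (G l)\<rbrakk>
      \<Longrightarrow> rop x (l, a \<otimes>\<^bsub>G l\<^esub> b) = rop (rop x (l, a)) (l, b)"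
    and rop_one: "\<lbrakk>x \<in> mgr_carrier L G; l \<in> L\<rbrakk> \<Longrightarrow> rop x (l, \<one>\<^bsub>G l\<^esub>) = x"
    and rop_distrib: "\<lbrakk>x \<in> mgr_carrier L G; y \<in> mgr_carrier L G; z \<in> mgr_carrier L G\<rbrakk>
      \<Longrightarrow> rop (rop x y) z = rop (rop x z) (rop y z)"
    and rop_same: "\<lbrakk>l \<in> L; a \<in> carrier (G l); b \<in> carrier (G l); y \<in> mgr_carrier L G\<rbrakk>
      \<Longrightarrow> fst (rop (l, a) y) = fst (rop (l, b) y)"
    and mult_rop: "\<lbrakk>l \<in> L; a \<in> carrier (G l); b \<in> carrier (G l); y \<in> mgr_carrier L G\<rbrakk>
      \<Longrightarrow> rop (l, a \<otimes>\<^bsub>G l\<^esub> b) y = mgr_mult G (rop (l, a) y) (rop (l, b) y)"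

locale mgr_set = multiple_group_rack L G rop
  for L :: "'l set"
    and G :: "'l \<Rightarrow> ('a, 'm) monoid_scheme"
    and rop :: "'l \<times> 'a \<Rightarrow> 'l \<times> 'a \<Rightarrow> 'l \<times> 'a" +
  fixes Y :: "'y set"
    and act :: "'y \<Rightarrow> 'l \<times> 'a \<Rightarrow> 'y"
  assumes nonempty: "Y \<noteq> {}"
    and act_closed: "\<lbrakk>v \<in> Y; x \<in> mgr_carrier L G\<rbrakk> \<Longrightarrow> act v x \<in> Y"
    and act_one: "\<lbrakk>v \<in> Y; l \<in> L\<rbrakk> \<Longrightarrow> act v (l, \<one>\<^bsub>G l\<^esub>) = v"
    and act_mult: "\<lbrakk>v \<in> Y; l \<in> L; a \<in> carrier (G l); b \<in> carrier (G l)\<rbrakk>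
      \<Longrightarrow> act v (l, a \<otimes>\<^bsub>G l\<^esub> b) = act (act v (l, a)) (l, b)"
    and act_distrib: "\<lbrakk>v \<in> Y; x \<in> mgr_carrier L G; y \<in> mgr_carrier L G\<rbrakk>
      \<Longrightarrow> act (act v x) y = act (act v y) (rop x y)"


text \<open>The symbol \<open>\<langle>v\<rangle>\<langle>x_1\<rangle>\<dots>\<langle>x_k\<rangle>\<close> is the pair of \<open>v\<close> and the list of the
  sequences \<open>x_1, \<dots>, x_k\<close>. List positions count from 0, so \<open>x_i\<close> is \<open>xss ! (i - 1)\<close>.\<close>

type_synonym ('y, 'x) mgr_symbol = "'y \<times> 'x list list"

definition total_length :: "'x list list \<Rightarrow> nat"
  where "total_length xss = sum_list (map length xss)"

definition mgr_basis ::
    "'l set \<Rightarrow> ('l \<Rightarrow> ('a, 'm) monoid_scheme) \<Rightarrow> 'y set \<Rightarrow> int \<Rightarrow> ('y, 'l \<times> 'a) mgr_symbol set"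
  where "mgr_basis L G Y n = {(v, xss). v \<in> Y
    \<and> (\<forall>xs\<in>set xss. xs \<noteq> [] \<and> (\<exists>l\<in>L. set xs \<subseteq> {l} \<times> carrier (G l)))
    \<and> int (total_length xss) = n}"

text \<open>For \<open>n < 0\<close> the basis is empty and the chain group is trivial.\<close>

definition mgr_chain_group ::
    "'l set \<Rightarrow> ('l \<Rightarrow> ('a, 'm) monoid_scheme) \<Rightarrow> 'y set \<Rightarrow> int
      \<Rightarrow> (('y, 'l \<times> 'a) mgr_symbol \<Rightarrow>\<^sub>0 int) monoid"
  where "mgr_chain_group L G Y n = free_Abelian_group (mgr_basis L G Y n)"

definition symbol_op ::
    "('x \<Rightarrow> 'x \<Rightarrow> 'x) \<Rightarrow> ('y \<Rightarrow> 'x \<Rightarrow> 'y) \<Rightarrow> ('y, 'x) mgr_symbol \<Rightarrow> 'x \<Rightarrow> ('y, 'x) mgr_symbol"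
  where "symbol_op rop act s y = (act (fst s) y, map (map (\<lambda>x. rop x y)) (snd s))"

text \<open>\<open>seq_face m j xs\<close> is \<open>xs\<^sup>j\<close> for a non-empty \<open>xs\<close> and \<open>0 \<le> j \<le> length xs\<close>.\<close>

definition seq_face :: "('x \<Rightarrow> 'x \<Rightarrow> 'x) \<Rightarrow> nat \<Rightarrow> 'x list \<Rightarrow> 'x list"
  where "seq_face m j xs =
    (if j = 0 then tl xs
     else if j = length xs then butlast xs
     else take (j - 1) xs @ [m (xs ! (j - 1)) (xs ! j)] @ drop (j + 1) xs)"

text \<open>\<open>symbol_append s xs yss\<close> is \<open>s\<langle>xs\<rangle>\<langle>yss_1\<rangle>\<dots>\<close>, where an empty factor \<open>\<langle>xs\<rangle>\<close> is deleted.\<close>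

definition symbol_append ::
    "('y, 'x) mgr_symbol \<Rightarrow> 'x list \<Rightarrow> 'x list list \<Rightarrow> ('y, 'x) mgr_symbol"
  where "symbol_append s xs yss = (fst s, snd s @ (if xs = [] then [] else [xs]) @ yss)"

definition symbol_boundary ::
    "('x \<Rightarrow> 'x \<Rightarrow> 'x) \<Rightarrow> ('x \<Rightarrow> 'x \<Rightarrow> 'x) \<Rightarrow> ('y \<Rightarrow> 'x \<Rightarrow> 'y)
      \<Rightarrow> ('y, 'x) mgr_symbol \<Rightarrow> (('y, 'x) mgr_symbol \<Rightarrow>\<^sub>0 int)"
  where "symbol_boundary m rop act s =
    (let v = fst s; xss = snd s in
     \<Sum>i<length xss.
       let pre = (v, take i xss); xs = xss ! i; post = drop (i + 1) xss in
       frag_cmul ((- 1) ^ total_length (take i xss))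
        (frag_of (symbol_append (symbol_op rop act pre (xs ! 0)) (seq_face m 0 xs) post)
         + (\<Sum>j = 1..length xs.
              frag_cmul ((- 1) ^ j) (frag_of (symbol_append pre (seq_face m j xs) post)))))"

text \<open>\<open>frag_extend\<close> extends a map on basis elements to the homomorphism on formal
  integer combinations.\<close>

definition mgr_boundary ::
    "('l \<Rightarrow> ('a, 'm) monoid_scheme) \<Rightarrow> ('l \<times> 'a \<Rightarrow> 'l \<times> 'a \<Rightarrow> 'l \<times> 'a)
      \<Rightarrow> ('y \<Rightarrow> 'l \<times> 'a \<Rightarrow> 'y) \<Rightarrow> int
      \<Rightarrow> (('y, 'l \<times> 'a) mgr_symbol \<Rightarrow>\<^sub>0 int) \<Rightarrow> (('y, 'l \<times> 'a) mgr_symbol \<Rightarrow>\<^sub>0 int)"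
  where "mgr_boundary G rop act n c =
    (if n \<le> 0 then 0 else frag_extend (symbol_boundary (mgr_mult G) rop act) c)"


definition chain_complex :: "(int \<Rightarrow> ('c, 'm) monoid_scheme) \<Rightarrow> (int \<Rightarrow> 'c \<Rightarrow> 'c) \<Rightarrow> bool"
  where "chain_complex C d \<longleftrightarrow>
    (\<forall>n. comm_group (C n)) \<and>
    (\<forall>n. d n \<in> hom (C n) (C (n - 1))) \<and>
    (\<forall>n. \<forall>c\<in>carrier (C n). d (n - 1) (d n c) = \<one>\<^bsub>C (n - 2)\<^esub>)"

end

theory Submission
  imports Defs
begin

text \<open>Symbols are built by appending one factor at a time, and the boundary respects this. Write
  \<open>s\<langle>xs\<rangle>\<close> for the symbol \<open>s\<close> of degree \<open>n\<close> with the factor \<open>xs\<close> appended, and \<open>D_xs s\<close> for the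
  alternating sum of the faces of that last factor, the zeroth of which also acts on \<open>s\<close> by the first
  entry of \<open>xs\<close>. A face never changes a later factor, so there is a Leibniz rule
  (\<open>symbol_boundary_append\<close>)

    \<open>\<partial> (s\<langle>xs\<rangle>) = (\<partial> s)\<langle>xs\<rangle> + (-1)^n D_xs s\<close>.

  With \<open>D_[] = 0\<close> it holds for the empty factor as well, so faces that delete a factor need no
  separate treatment.

  Two facts about \<open>D\<close> carry the proof. The faces of the pair \<open>(s, xs)\<close> satisfy the presimplicial
  identities, because the groups are associative and the action of a product is the composite of the
  actions; hence the alternating sum of \<open>D\<close> over the faces of \<open>(s, xs)\<close> is zero
  (\<open>alternating_factor_boundary_eq_0\<close>). The operator of an element \<open>y\<close> commutes with \<open>\<partial>\<close>, by
  self-distributivity and because it is multiplicative on each group (\<open>symbol_boundary_op\<close>).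
  Combined with the Leibniz rule, these give \<open>\<partial> D_xs = D_xs \<partial>\<close> (\<open>boundary_factor_boundary\<close>). In

    \<open>\<partial> \<partial> (s\<langle>xs\<rangle>) = (\<partial> \<partial> s)\<langle>xs\<rangle> + (-1)^(n-1) D_xs (\<partial> s) + (-1)^n \<partial> (D_xs s)\<close>

  the last two terms then cancel, and the first one vanishes by induction on the number of
  factors.\<close>

section \<open>Formal integer combinations\<close>

lemma frag_extend_frag_of: "frag_extend frag_of c = c"
  by (metis frag_expansion)

lemma frag_extend_add_fun:
  "frag_extend (\<lambda>s. f s + g s) c = frag_extend f c + frag_extend g c"
  by (simp add: frag_extend_def frag_cmul_distrib2 sum.distrib)

lemma frag_extend_cmul_fun:
  "frag_extend (\<lambda>s. frag_cmul k (f s)) c = frag_cmul k (frag_extend f c)"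
  by (simp add: frag_extend_def frag_cmul_sum mult.commute)

lemma frag_extend_sum_cmul_fun:
  "frag_extend (\<lambda>s. \<Sum>j\<in>J. frag_cmul (k j) (f j s)) c
    = (\<Sum>j\<in>J. frag_cmul (k j) (frag_extend (f j) c))"
  unfolding frag_extend_def frag_cmul_sum by (subst sum.swap) (simp add: mult.commute)

lemma frag_extend_frag_extend:
  "frag_extend f (frag_extend g c) = frag_extend (\<lambda>s. frag_extend f (g s)) c"
  using subset_UNIV by (induction c rule: frag_induction) (auto simp: frag_extend_diff)

lemma frag_extend_sum_cmul:
  assumes "finite J"
  shows "frag_extend f (\<Sum>j\<in>J. frag_cmul (k j) (g j)) = (\<Sum>j\<in>J. frag_cmul (k j) (frag_extend f (g j)))"
  using assms by (simp add: frag_extend_sum o_def frag_extend_cmul)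

text \<open>The cancellation that makes the alternating sum of presimplicial face maps square to zero:
  passing from \<open>m\<close> to \<open>Suc m\<close> adds one row and one column to the array of terms, and the
  presimplicial identity matches them entry by entry with opposite signs.\<close>

lemma alternating_double_sum_eq_0:
  fixes f :: "nat \<Rightarrow> nat \<Rightarrow> 'b \<Rightarrow>\<^sub>0 int"
  assumes "\<And>i j. \<lbrakk>i < j; j \<le> Suc m\<rbrakk> \<Longrightarrow> f i j = f (j - 1) i"
  shows "(\<Sum>j\<le>Suc m. \<Sum>i\<le>m. frag_cmul ((- 1) ^ (i + j)) (f i j)) = 0"
  using assms
proof (induction m)
  case 0
  have "f 0 (Suc 0) = f 0 0" using 0[of 0 1] by simp
  then show ?case by simp
next
  case (Suc m)
  have IH: "(\<Sum>j\<le>Suc m. \<Sum>i\<le>m. frag_cmul ((- 1) ^ (i + j)) (f i j)) = 0"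
    by (rule Suc.IH) (use Suc.prems in simp)
  have last: "(\<Sum>i\<le>Suc m. frag_cmul ((- 1) ^ (i + Suc (Suc m))) (f i (Suc (Suc m))))
      = - (\<Sum>j\<le>Suc m. frag_cmul ((- 1) ^ (Suc m + j)) (f (Suc m) j))"
    unfolding sum_negf[symmetric]
  proof (rule sum.cong)
    fix i assume "i \<in> {..Suc m}"
    then have "f i (Suc (Suc m)) = f (Suc m) i" using Suc.prems[of i "Suc (Suc m)"] by simp
    then show "frag_cmul ((- 1) ^ (i + Suc (Suc m))) (f i (Suc (Suc m)))
        = - frag_cmul ((- 1) ^ (Suc m + i)) (f (Suc m) i)"
      by (simp add: add.commute)
  qed simp
  have "(\<Sum>j\<le>Suc (Suc m). \<Sum>i\<le>Suc m. frag_cmul ((- 1) ^ (i + j)) (f i j))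
    = (\<Sum>j\<le>Suc m. (\<Sum>i\<le>m. frag_cmul ((- 1) ^ (i + j)) (f i j)) + frag_cmul ((- 1) ^ (Suc m + j)) (f (Suc m) j))
      + (\<Sum>i\<le>Suc m. frag_cmul ((- 1) ^ (i + Suc (Suc m))) (f i (Suc (Suc m))))"
    by (subst sum.atMost_Suc) (subst sum.atMost_Suc, rule refl)
  also have "\<dots> = 0"
    unfolding sum.distrib IH last by simp
  finally show ?case .
qed

section \<open>Faces of a sequence\<close>

lemma seq_face_Cons_0 [simp]: "seq_face m 0 (x # xs) = xs"
  by (simp add: seq_face_def)

lemma seq_face_singleton_1 [simp]: "seq_face m (Suc 0) [x] = []"
  by (simp add: seq_face_def)

lemma seq_face_Cons_Cons_1 [simp]: "seq_face m (Suc 0) (x # y # xs) = m x y # xs"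
  by (simp add: seq_face_def)

lemma seq_face_Cons_Suc_Suc [simp]:
  assumes "xs \<noteq> []"
  shows "seq_face m (Suc (Suc j)) (x # xs) = x # seq_face m (Suc j) xs"
  using assms by (auto simp: seq_face_def)

lemma length_seq_face:
  "\<lbrakk>xs \<noteq> []; j \<le> length xs\<rbrakk> \<Longrightarrow> length (seq_face m j xs) = length xs - 1"
  by (auto simp: seq_face_def)

text \<open>The presimplicial identities. If \<open>2 \<le> i\<close>, both sides keep the first entry and the claim passes
  to the tail, so only \<open>i = 0\<close> and \<open>i = 1\<close> are computed. Associativity enters through
  \<open>i = 1\<close>, \<open>j = 2\<close>, where the first three entries are multiplied together.\<close>

lemma seq_face_seq_face:
  assumes "i < j" "j \<le> length xs" "2 \<le> length xs"
    and "\<And>x y z. \<lbrakk>x \<in> set xs; y \<in> set xs; z \<in> set xs\<rbrakk> \<Longrightarrow> m (m x y) z = m x (m y z)"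
  shows "seq_face m i (seq_face m j xs) = seq_face m (j - 1) (seq_face m i xs)"
  using assms
proof (induction xs arbitrary: i j)
  case Nil
  then show ?case by simp
next
  case (Cons x xs)
  then obtain y zs where xs: "xs = y # zs" by (cases xs) auto
  obtain j' where j: "j = Suc j'" using Cons.prems(1) by (cases j) auto
  show ?case
  proof (cases i)
    case 0
    then show ?thesis using xs j by (cases j') auto
  next
    case i: (Suc i')
    then obtain j'' where j': "j' = Suc j''" using Cons.prems(1) j by (cases j') auto
    show ?thesis
    proof (cases i')
      case 0
      then show ?thesis using xs i j j' Cons.prems
        by (cases j''; cases zs) auto
    next
      case i': (Suc i'')
      then obtain j3 where j'': "j'' = Suc j3" using Cons.prems(1) i j j' by (cases j'') auto
      have len: "2 \<le> length xs" using Cons.prems i i' j j' j'' by simp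
      have "seq_face m i' (seq_face m j' xs) = seq_face m (j' - 1) (seq_face m i' xs)"
        by (rule Cons.IH) (use Cons.prems i j len in auto)
      moreover have "seq_face m j' xs \<noteq> []" "seq_face m i' xs \<noteq> []"
        using length_seq_face[of xs j' m] length_seq_face[of xs i' m] len Cons.prems i j
        by (auto simp: xs)
      ultimately show ?thesis using xs i i' j j' j'' by simp
    qed
  qed
qed

lemma map_seq_face:
  assumes "\<And>x y. \<lbrakk>x \<in> set xs; y \<in> set xs\<rbrakk> \<Longrightarrow> f (m x y) = m (f x) (f y)"
    and "xs \<noteq> []" "j \<le> length xs"
  shows "map f (seq_face m j xs) = seq_face m j (map f xs)"
  using assms by (auto simp: seq_face_def map_tl map_butlast take_map drop_map)

lemma symbol_append_Nil_Nil: "symbol_append s [] [] = s"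
  by (simp add: symbol_append_def)

lemma symbol_append_append_Nil:
  assumes "ys \<noteq> []"
  shows "symbol_append s xs (yss @ [ys]) = symbol_append (symbol_append s xs yss) ys []"
  using assms by (simp add: symbol_append_def)

lemma total_length_snoc: "total_length (xss @ [xs]) = total_length xss + length xs"
  by (simp add: total_length_def)

section \<open>Boundary of the last factor\<close>

context mgr_set
begin

abbreviation mult where "mult \<equiv> mgr_mult G"
abbreviation symbol_bd where "symbol_bd \<equiv> symbol_boundary mult rop act"
abbreviation basis where "basis n \<equiv> mgr_basis L G Y (int n)"

text \<open>Factors of basis symbols satisfy this and are non-empty; their faces may be empty.\<close>

definition group_seq :: "('l \<times> 'a) list \<Rightarrow> bool"
  where "group_seq xs \<longleftrightarrow> (\<exists>l\<in>L. set xs \<subseteq> {l} \<times> carrier (G l))"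

definition append_factor ::
    "('l \<times> 'a) list \<Rightarrow> (('y, 'l \<times> 'a) mgr_symbol \<Rightarrow>\<^sub>0 int) \<Rightarrow> (('y, 'l \<times> 'a) mgr_symbol \<Rightarrow>\<^sub>0 int)"
  where "append_factor xs = frag_extend (\<lambda>s. frag_of (symbol_append s xs []))"

text \<open>The effect on \<open>s\<close> of taking the \<open>j\<close>-th face of the last factor of \<open>s\<langle>xs\<rangle>\<close>.\<close>

definition prefix_face ::
    "nat \<Rightarrow> ('l \<times> 'a) list \<Rightarrow> ('y, 'l \<times> 'a) mgr_symbol \<Rightarrow> ('y, 'l \<times> 'a) mgr_symbol"
  where "prefix_face j xs s = (if j = 0 then symbol_op rop act s (hd xs) else s)"

text \<open>For \<open>xs = []\<close> the sum would consist of a meaningless term for \<open>j = 0\<close>; appending an empty factor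
  changes nothing, so it has to contribute nothing to the boundary.\<close>

definition factor_boundary ::
    "('l \<times> 'a) list \<Rightarrow> ('y, 'l \<times> 'a) mgr_symbol \<Rightarrow> (('y, 'l \<times> 'a) mgr_symbol \<Rightarrow>\<^sub>0 int)"
  where "factor_boundary xs s = (if xs = [] then 0 else
    \<Sum>j\<le>length xs. frag_cmul ((- 1) ^ j)
      (frag_of (symbol_append (prefix_face j xs s) (seq_face mult j xs) [])))"

text \<open>The Leibniz rule: a face of an earlier factor leaves the last one unchanged, since the first
  entry of a factor acts only on what stands to its left.\<close>

lemma symbol_boundary_append:
  "symbol_bd (symbol_append s xs [])
    = append_factor xs (symbol_bd s)
      + frag_cmul ((- 1) ^ total_length (snd s)) (factor_boundary xs s)"
proof (cases "xs = []")
  case True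
  then show ?thesis
    by (simp add: append_factor_def factor_boundary_def symbol_append_Nil_Nil frag_extend_frag_of)
next
  case False
  obtain v xss where s: "s = (v, xss)" by (cases s)
  have app: "symbol_append s xs [] = (v, xss @ [xs])"
    using False by (simp add: s symbol_append_def)
  have split: "{..length xs} = insert 0 {1..length xs}" by auto
  have fb: "factor_boundary xs s =
      frag_of (symbol_append (symbol_op rop act s (xs ! 0)) (seq_face mult 0 xs) [])
      + (\<Sum>j = 1..length xs. frag_cmul ((- 1) ^ j) (frag_of (symbol_append s (seq_face mult j xs) [])))"
    using False by (simp add: factor_boundary_def split prefix_face_def hd_conv_nth)
  have A: "append_factor xs (frag_of (symbol_append t zs post))
      = frag_of (symbol_append t zs (post @ [xs]))" for t zs post
    using False by (simp add: append_factor_def symbol_append_append_Nil)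
  have A_lin: "append_factor xs (a + b) = append_factor xs a + append_factor xs b"
    "append_factor xs (frag_cmul k a) = frag_cmul k (append_factor xs a)"
    "finite J \<Longrightarrow> append_factor xs (sum g J) = (\<Sum>j\<in>J. append_factor xs (g j))"
    for a b k J and g :: "nat \<Rightarrow> _"
    by (simp_all add: append_factor_def frag_extend_add frag_extend_cmul frag_extend_sum o_def)
  show ?thesis
    unfolding app unfolding symbol_boundary_def Let_def fst_conv snd_conv s
    by (simp add: A A_lin fb[unfolded s] nth_append)
qed

section \<open>Validity and the action\<close>

lemma rop_mult_pair:
  assumes "x \<in> mgr_carrier L G" "l \<in> L" "y \<in> {l} \<times> carrier (G l)" "z \<in> {l} \<times> carrier (G l)"
  shows "rop x (mult y z) = rop (rop x y) z"
  using rop_mult[OF assms(1,2)] assms(3,4) by (auto simp: mgr_mult_def)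

lemma act_mult_pair:
  assumes "v \<in> Y" "l \<in> L" "y \<in> {l} \<times> carrier (G l)" "z \<in> {l} \<times> carrier (G l)"
  shows "act v (mult y z) = act (act v y) z"
  using act_mult[OF assms(1,2)] assms(3,4) by (auto simp: mgr_mult_def)

lemma mult_rop_pair:
  assumes "l \<in> L" "x \<in> {l} \<times> carrier (G l)" "y \<in> {l} \<times> carrier (G l)" "z \<in> mgr_carrier L G"
  shows "rop (mult x y) z = mult (rop x z) (rop y z)"
  using mult_rop[OF assms(1) _ _ assms(4)] assms(2,3) by (auto simp: mgr_mult_def)

lemma mult_closed_pair:
  assumes "l \<in> L" "x \<in> {l} \<times> carrier (G l)" "y \<in> {l} \<times> carrier (G l)"
  shows "mult x y \<in> {l} \<times> carrier (G l)"
  using assms(2,3) monoid.m_closed[OF group.is_monoid[OF groups[OF assms(1)]]] by (auto simp: mgr_mult_def)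

lemma mult_assoc_pair:
  assumes "l \<in> L" "x \<in> {l} \<times> carrier (G l)" "y \<in> {l} \<times> carrier (G l)" "z \<in> {l} \<times> carrier (G l)"
  shows "mult (mult x y) z = mult x (mult y z)"
  using assms(2-4) monoid.m_assoc[OF group.is_monoid[OF groups[OF assms(1)]]] by (auto simp: mgr_mult_def)

lemma group_seq_carrier: "\<lbrakk>group_seq xs; x \<in> set xs\<rbrakk> \<Longrightarrow> x \<in> mgr_carrier L G"
  by (auto simp: group_seq_def mgr_carrier_def)

lemma group_seq_map_rop:
  assumes "group_seq xs" "y \<in> mgr_carrier L G"
  shows "group_seq (map (\<lambda>x. rop x y) xs)"
proof (cases xs)
  case Nil
  then show ?thesis using assms(1) by (simp add: group_seq_def)
next
  case (Cons x xs')
  obtain l where l: "l \<in> L" "set xs \<subseteq> {l} \<times> carrier (G l)"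
    using assms(1) by (auto simp: group_seq_def)
  have carr: "rop z y \<in> mgr_carrier L G" if "z \<in> set xs" for z
    using that assms group_seq_carrier rop_closed by blast
  have "fst (rop z y) = fst (rop x y)" if "z \<in> set xs" for z
  proof -
    have "z \<in> {l} \<times> carrier (G l)" "x \<in> {l} \<times> carrier (G l)" using that l Cons by auto
    then show ?thesis using rop_same[OF l(1) _ _ assms(2)] by auto
  qed
  then have "rop z y \<in> {fst (rop x y)} \<times> carrier (G (fst (rop x y)))" if "z \<in> set xs" for z
    using carr[OF that] that unfolding mgr_carrier_def by (metis SigmaE SigmaI fst_conv singletonI)
  moreover have "fst (rop x y) \<in> L" using carr[of x] Cons by (auto simp: mgr_carrier_def)
  ultimately show ?thesis unfolding group_seq_def set_map by blast
qed

lemma group_seq_face: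
  assumes "group_seq xs" "xs \<noteq> []" "j \<le> length xs"
  shows "group_seq (seq_face mult j xs)"
proof -
  obtain l where l: "l \<in> L" "set xs \<subseteq> {l} \<times> carrier (G l)"
    using assms(1) by (auto simp: group_seq_def)
  have "set (seq_face mult j xs) \<subseteq> {l} \<times> carrier (G l)"
  proof -
    consider "j = 0" | "j = length xs" | "0 < j" "j < length xs" using assms by linarith
    then show ?thesis
    proof cases
      case 1
      then show ?thesis using l(2) by (auto simp: seq_face_def dest: list.set_sel(2)[OF assms(2)])
    next
      case 2
      then show ?thesis using l(2) assms(2) by (auto simp: seq_face_def dest: in_set_butlastD)
    next
      case 3
      have "mult (xs ! (j - 1)) (xs ! j) \<in> {l} \<times> carrier (G l)"
        by (rule mult_closed_pair[OF l(1)]) (use l(2) 3 nth_mem in force)+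
      then show ?thesis using l(2) 3 by (auto simp: seq_face_def dest: in_set_takeD in_set_dropD)
    qed
  qed
  then show ?thesis using l(1) by (auto simp: group_seq_def)
qed

lemma mem_basis_iff:
  "(v, xss) \<in> basis n \<longleftrightarrow> v \<in> Y \<and> (\<forall>xs\<in>set xss. xs \<noteq> [] \<and> group_seq xs) \<and> total_length xss = n"
  by (auto simp: mgr_basis_def group_seq_def)

lemma basis_snoc_iff:
  "(v, xss @ [xs]) \<in> basis n \<longleftrightarrow>
    xs \<noteq> [] \<and> group_seq xs \<and> length xs \<le> n \<and> (v, xss) \<in> basis (n - length xs)"
  by (auto simp: mem_basis_iff total_length_snoc)

lemma basis_degree_pos:
  assumes "(v, xss) \<in> basis n" "xss \<noteq> []"
  shows "0 < n"
  using assms by (cases xss) (auto simp: mem_basis_iff total_length_def)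

lemma total_length_basis: "s \<in> basis n \<Longrightarrow> total_length (snd s) = n"
  by (cases s) (simp add: mem_basis_iff)

lemma symbol_append_basis:
  assumes "s \<in> basis n" "group_seq xs"
  shows "symbol_append s xs [] \<in> basis (n + length xs)"
  using assms by (cases s) (auto simp: symbol_append_def mem_basis_iff total_length_snoc simp del: of_nat_add)

lemma symbol_op_basis:
  assumes "s \<in> basis n" "y \<in> mgr_carrier L G"
  shows "symbol_op rop act s y \<in> basis n"
  using assms
  by (cases s) (auto simp: symbol_op_def mem_basis_iff act_closed group_seq_map_rop total_length_def o_def)

lemma prefix_face_basis:
  assumes "s \<in> basis n" "group_seq xs" "xs \<noteq> []"
  shows "prefix_face j xs s \<in> basis n"
  using assms by (auto simp: prefix_face_def intro!: symbol_op_basis group_seq_carrier)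

lemma symbol_entry_carrier:
  assumes "s \<in> basis n" "xs \<in> set (snd s)" "x \<in> set xs"
  shows "x \<in> mgr_carrier L G"
  using assms by (cases s) (auto simp: mem_basis_iff intro: group_seq_carrier)

lemma symbol_op_mult:
  assumes "s \<in> basis n" "l \<in> L" "y \<in> {l} \<times> carrier (G l)" "z \<in> {l} \<times> carrier (G l)"
  shows "symbol_op rop act s (mult y z) = symbol_op rop act (symbol_op rop act s y) z"
proof -
  have "fst s \<in> Y" using assms(1) by (cases s) (simp add: mem_basis_iff)
  then show ?thesis
    using assms by (auto simp: symbol_op_def act_mult_pair rop_mult_pair symbol_entry_carrier)
qed

lemma symbol_op_distrib:
  assumes "s \<in> basis n" "x \<in> mgr_carrier L G" "y \<in> mgr_carrier L G"
  shows "symbol_op rop act (symbol_op rop act s x) y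
    = symbol_op rop act (symbol_op rop act s y) (rop x y)"
proof -
  have "fst s \<in> Y" using assms(1) by (cases s) (simp add: mem_basis_iff)
  then show ?thesis
    using assms by (auto simp: symbol_op_def act_distrib[of "fst s"] symbol_entry_carrier
        intro!: rop_distrib)
qed

lemma symbol_op_append:
  "symbol_op rop act (symbol_append s xs []) y
    = symbol_append (symbol_op rop act s y) (map (\<lambda>x. rop x y) xs) []"
  by (simp add: symbol_op_def symbol_append_def)

section \<open>The boundary on chains\<close>

lemma keys_factor_boundary:
  assumes "s \<in> basis n" "group_seq xs" "xs \<noteq> []"
  shows "Poly_Mapping.keys (factor_boundary xs s) \<subseteq> basis (n + length xs - 1)"
proof -
  have "symbol_append (prefix_face j xs s) (seq_face mult j xs) [] \<in> basis (n + length xs - 1)"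
    if "j \<le> length xs" for j
    using symbol_append_basis[OF prefix_face_basis[OF assms, of j] group_seq_face[OF assms(2,3) that]]
      length_seq_face[OF assms(3) that, of mult] assms(3) by (cases xs) auto
  then have "Poly_Mapping.keys (frag_cmul ((- 1) ^ j)
        (frag_of (symbol_append (prefix_face j xs s) (seq_face mult j xs) []))) \<subseteq> basis (n + length xs - 1)"
    if "j \<le> length xs" for j
    using that by (auto simp del: of_nat_add of_nat_diff)
  then show ?thesis
    using assms(3) unfolding factor_boundary_def
    by (auto dest!: subsetD[OF keys_sum])
qed

text \<open>The truncated subtraction is harmless: for \<open>n = 0\<close> there are no factors and the boundary is
  zero.\<close>

lemma keys_symbol_boundary:
  "s \<in> basis n \<Longrightarrow> Poly_Mapping.keys (symbol_bd s) \<subseteq> basis (n - 1)"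
proof (induction "snd s" arbitrary: s n rule: rev_induct)
  case Nil
  then show ?case by (simp add: symbol_boundary_def)
next
  case (snoc xs xss)
  define t where "t = (fst s, xss)"
  have s': "s = (fst s, xss @ [xs])" using snoc.hyps(2) by (simp add: prod_eq_iff)
  then have xs: "xs \<noteq> []" "group_seq xs" "length xs \<le> n" and t: "t \<in> basis (n - length xs)"
    using snoc.prems basis_snoc_iff[of "fst s" xss xs n] unfolding t_def by metis+
  have s: "s = symbol_append t xs []" using s' xs(1) by (simp add: t_def symbol_append_def)
  have "Poly_Mapping.keys (append_factor xs (symbol_bd t)) \<subseteq> basis (n - 1)"
  proof (cases "xss = []")
    case True
    then show ?thesis by (simp add: append_factor_def symbol_boundary_def t_def)
  next
    case False
    have "1 \<le> n - length xs"
      using basis_degree_pos[OF t[unfolded t_def] False] by simp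
    then have *: "n - length xs - 1 + length xs = n - 1" by simp
    have "symbol_append u xs [] \<in> basis (n - 1)" if "u \<in> Poly_Mapping.keys (symbol_bd t)" for u
    proof -
      have "u \<in> basis (n - length xs - 1)"
        using snoc.hyps(1)[of t, OF _ t] that by (auto simp: t_def)
      from symbol_append_basis[OF this xs(2)] show ?thesis unfolding * .
    qed
    then show ?thesis unfolding append_factor_def
      by (auto dest!: subsetD[OF keys_frag_extend])
  qed
  moreover have "Poly_Mapping.keys (factor_boundary xs t) \<subseteq> basis (n - 1)"
    using keys_factor_boundary[OF t xs(2,1)] xs(3) by simp
  ultimately show ?case
    unfolding s symbol_boundary_append
    by (auto dest!: subsetD[OF keys_add])
qed

text \<open>The presimplicial identities on the prefix. For \<open>i = 0\<close>, \<open>j = 1\<close> the identity is the law that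
  the action of a product is the composite of the actions. For \<open>i = 0\<close>, \<open>2 \<le> j\<close> it holds because the
  \<open>j\<close>-th face keeps the first entry, and for \<open>0 < i\<close> both sides are \<open>s\<close>.\<close>

lemma prefix_face_prefix_face:
  assumes "s \<in> basis n" "group_seq xs" "2 \<le> length xs" "i < j" "j \<le> length xs"
  shows "prefix_face i (seq_face mult j xs) (prefix_face j xs s)
    = prefix_face (j - 1) (seq_face mult i xs) (prefix_face i xs s)"
proof (cases "i = 0")
  case True
  obtain x y zs where xs: "xs = x # y # zs" using assms(3) by (cases xs rule: remdups_adj.cases) auto
  obtain l where l: "l \<in> L" "set xs \<subseteq> {l} \<times> carrier (G l)"
    using assms(2) by (auto simp: group_seq_def)
  show ?thesis
  proof (cases "j = 1")
    case j: True
    have "symbol_op rop act s (mult x y) = symbol_op rop act (symbol_op rop act s x) y"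
      by (rule symbol_op_mult[OF assms(1) l(1)]) (use l(2) xs in auto)
    then show ?thesis by (simp add: True j prefix_face_def xs)
  next
    case False
    then obtain j' where "j = Suc (Suc j')" using assms(4) by (metis One_nat_def not0_implies_Suc not_less_zero)
    then show ?thesis by (simp add: True prefix_face_def xs)
  qed
next
  case False
  then show ?thesis using assms(4) by (simp add: prefix_face_def)
qed

text \<open>This is the part of the square of the boundary in which both faces are taken in the last factor.
  A one-element factor disappears after one face and has no second one; otherwise the presimplicial
  identities of prefix and factor combine.\<close>

lemma alternating_factor_boundary_eq_0:
  assumes "s \<in> basis n" "group_seq xs" "xs \<noteq> []"
  shows "(\<Sum>j\<le>length xs. frag_cmul ((- 1) ^ j)
    (factor_boundary (seq_face mult j xs) (prefix_face j xs s))) = 0"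
proof (cases "length xs = 1")
  case True
  then have "seq_face mult j xs = []" if "j \<le> length xs" for j
    using length_seq_face[OF assms(3) that, of mult] by simp
  then show ?thesis by (simp add: factor_boundary_def)
next
  case False
  then obtain m where m: "length xs = Suc (Suc m)"
    using assms(3) by (metis One_nat_def length_0_conv not0_implies_Suc)
  obtain l where l: "l \<in> L" "set xs \<subseteq> {l} \<times> carrier (G l)"
    using assms(2) by (auto simp: group_seq_def)
  define f where "f i j = frag_of (symbol_append
    (prefix_face i (seq_face mult j xs) (prefix_face j xs s))
    (seq_face mult i (seq_face mult j xs)) [])" for i j
  have eq: "f i j = f (j - 1) i" if "i < j" "j \<le> Suc (Suc m)" for i j
  proof -
    have "seq_face mult i (seq_face mult j xs) = seq_face mult (j - 1) (seq_face mult i xs)"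
      by (rule seq_face_seq_face) (use that m mult_assoc_pair[OF l(1) l(2)[THEN subsetD] l(2)[THEN subsetD] l(2)[THEN subsetD]] in auto)
    then show ?thesis
      using prefix_face_prefix_face[OF assms(1,2), of i j] that m by (simp add: f_def)
  qed
  have "(\<Sum>j\<le>length xs. frag_cmul ((- 1) ^ j)
      (factor_boundary (seq_face mult j xs) (prefix_face j xs s)))
    = (\<Sum>j\<le>Suc (Suc m). \<Sum>i\<le>Suc m. frag_cmul ((- 1) ^ (i + j)) (f i j))"
  proof (rule sum.cong)
    fix j assume "j \<in> {..Suc (Suc m)}"
    then have len: "length (seq_face mult j xs) = Suc m"
      using length_seq_face[OF assms(3), of j mult] m by simp
    then have "seq_face mult j xs \<noteq> []" by auto
    then show "frag_cmul ((- 1) ^ j) (factor_boundary (seq_face mult j xs) (prefix_face j xs s))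
        = (\<Sum>i\<le>Suc m. frag_cmul ((- 1) ^ (i + j)) (f i j))"
      unfolding factor_boundary_def len f_def
      by (simp add: frag_cmul_sum frag_cmul_distrib2 power_add mult.commute del: sum.atMost_Suc)
  qed (simp add: m)
  also have "\<dots> = 0"
    by (rule alternating_double_sum_eq_0) (rule eq)
  finally show ?thesis .
qed

text \<open>Moving \<open>* y\<close> past the zeroth face is self-distributivity, and past the inner faces it is
  multiplicativity of \<open>* y\<close> on each group.\<close>

lemma factor_boundary_op:
  assumes "s \<in> basis n" "group_seq xs" "y \<in> mgr_carrier L G"
  shows "frag_extend (\<lambda>s. frag_of (symbol_op rop act s y)) (factor_boundary xs s)
    = factor_boundary (map (\<lambda>x. rop x y) xs) (symbol_op rop act s y)"
proof (cases "xs = []")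
  case True
  then show ?thesis by (simp add: factor_boundary_def)
next
  case False
  obtain l where l: "l \<in> L" "set xs \<subseteq> {l} \<times> carrier (G l)"
    using assms(2) by (auto simp: group_seq_def)
  have face: "map (\<lambda>x. rop x y) (seq_face mult j xs) = seq_face mult j (map (\<lambda>x. rop x y) xs)"
    if "j \<le> length xs" for j
    by (rule map_seq_face) (use False that mult_rop_pair[OF l(1) l(2)[THEN subsetD] l(2)[THEN subsetD] assms(3)] in auto)
  have pf: "symbol_op rop act (prefix_face j xs s) y
      = prefix_face j (map (\<lambda>x. rop x y) xs) (symbol_op rop act s y)" for j
    using False assms by (simp add: prefix_face_def hd_map symbol_op_distrib group_seq_carrier)
  show ?thesis
    using False by (simp add: factor_boundary_def frag_extend_sum_cmul symbol_op_append pf face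
        cong: sum.cong_simp)
qed

lemma symbol_boundary_op:
  assumes "s \<in> basis n" "y \<in> mgr_carrier L G"
  shows "symbol_bd (symbol_op rop act s y)
    = frag_extend (\<lambda>s. frag_of (symbol_op rop act s y)) (symbol_bd s)"
  using assms
proof (induction "snd s" arbitrary: s n rule: rev_induct)
  case Nil
  then show ?case by (simp add: symbol_boundary_def symbol_op_def)
next
  case (snoc xs xss)
  define t where "t = (fst s, xss)"
  let ?T = "frag_extend (\<lambda>s. frag_of (symbol_op rop act s y))"
  let ?xs = "map (\<lambda>x. rop x y) xs"
  have s': "s = (fst s, xss @ [xs])" using snoc.hyps(2) by (simp add: prod_eq_iff)
  then have xs: "xs \<noteq> []" "group_seq xs" and t: "t \<in> basis (n - length xs)"
    using snoc.prems basis_snoc_iff[of "fst s" xss xs n] unfolding t_def by metis+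
  have s: "s = symbol_append t xs []" using s' xs(1) by (simp add: t_def symbol_append_def)
  have IH: "symbol_bd (symbol_op rop act t y) = ?T (symbol_bd t)"
    by (rule snoc.hyps(1)[OF _ t snoc.prems(2)]) (simp add: t_def)
  have T_append: "?T (append_factor xs c) = append_factor ?xs (?T c)" for c
    by (simp add: append_factor_def frag_extend_frag_extend symbol_op_append)
  have "total_length (snd (symbol_op rop act t y)) = total_length (snd t)"
    using total_length_basis[OF t] total_length_basis[OF symbol_op_basis[OF t snoc.prems(2)]] by simp
  then show ?case
    unfolding s symbol_op_append symbol_boundary_append IH
    by (simp add: frag_extend_add frag_extend_cmul T_append factor_boundary_op[OF t xs(2) snoc.prems(2)])
qed

text \<open>Expanding \<open>\<partial>\<close> of each face of \<open>s\<langle>xs\<rangle>\<close> by the Leibniz rule, the terms in which \<open>\<partial>\<close> hits the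
  prefix add up to \<open>D_xs (\<partial> s)\<close>, and the others cancel by the presimplicial identities.\<close>

lemma boundary_factor_boundary:
  assumes "s \<in> basis n" "group_seq xs"
  shows "frag_extend symbol_bd (factor_boundary xs s) = frag_extend (factor_boundary xs) (symbol_bd s)"
proof (cases "xs = []")
  case True
  then show ?thesis by (simp add: factor_boundary_def frag_extend_eq_0)
next
  case False
  have pf: "symbol_bd (prefix_face j xs s)
      = frag_extend (\<lambda>s. frag_of (prefix_face j xs s)) (symbol_bd s)" for j
    using symbol_boundary_op[OF assms(1) group_seq_carrier[OF assms(2)]] False
    by (simp add: prefix_face_def frag_extend_frag_of)
  have len: "total_length (snd (prefix_face j xs s)) = n" for j
    using prefix_face_basis[OF assms False] by (rule total_length_basis)
  have face: "symbol_bd (symbol_append (prefix_face j xs s) (seq_face mult j xs) [])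
      = frag_extend (\<lambda>s. frag_of (symbol_append (prefix_face j xs s) (seq_face mult j xs) [])) (symbol_bd s)
        + frag_cmul ((- 1) ^ n) (factor_boundary (seq_face mult j xs) (prefix_face j xs s))" for j
    unfolding symbol_boundary_append len pf append_factor_def frag_extend_frag_extend by simp
  have "frag_extend symbol_bd (factor_boundary xs s)
    = (\<Sum>j\<le>length xs. frag_cmul ((- 1) ^ j)
        (symbol_bd (symbol_append (prefix_face j xs s) (seq_face mult j xs) [])))"
    using False by (simp add: factor_boundary_def frag_extend_sum_cmul)
  also have "\<dots> = (\<Sum>j\<le>length xs. frag_cmul ((- 1) ^ j)
        (frag_extend (\<lambda>s. frag_of (symbol_append (prefix_face j xs s) (seq_face mult j xs) [])) (symbol_bd s)))
      + frag_cmul ((- 1) ^ n) (\<Sum>j\<le>length xs. frag_cmul ((- 1) ^ j)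
          (factor_boundary (seq_face mult j xs) (prefix_face j xs s)))"
    unfolding face by (simp add: frag_cmul_distrib2 sum.distrib frag_cmul_sum mult.commute)
  also have "\<dots> = frag_extend (\<lambda>s. \<Sum>j\<le>length xs. frag_cmul ((- 1) ^ j)
        (frag_of (symbol_append (prefix_face j xs s) (seq_face mult j xs) []))) (symbol_bd s)"
    unfolding alternating_factor_boundary_eq_0[OF assms False] frag_extend_sum_cmul_fun by simp
  also have "\<dots> = frag_extend (factor_boundary xs) (symbol_bd s)"
    by (rule frag_extend_eq) (simp add: factor_boundary_def False)
  finally show ?thesis .
qed

lemma boundary_append_factor:
  assumes "Poly_Mapping.keys c \<subseteq> basis n"
  shows "frag_extend symbol_bd (append_factor xs c)
    = append_factor xs (frag_extend symbol_bd c)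
      + frag_cmul ((- 1) ^ n) (frag_extend (factor_boundary xs) c)"
proof -
  have "frag_extend symbol_bd (append_factor xs c)
      = frag_extend (\<lambda>s. append_factor xs (symbol_bd s) + frag_cmul ((- 1) ^ n) (factor_boundary xs s)) c"
    unfolding append_factor_def[of xs, THEN fun_cong, of c] frag_extend_frag_extend frag_extend_of
    by (rule frag_extend_eq) (use assms total_length_basis in \<open>auto simp: symbol_boundary_append\<close>)
  also have "\<dots> = append_factor xs (frag_extend symbol_bd c)
      + frag_cmul ((- 1) ^ n) (frag_extend (factor_boundary xs) c)"
    by (simp add: frag_extend_add_fun frag_extend_cmul_fun append_factor_def frag_extend_frag_extend)
  finally show ?thesis .
qed

lemma boundary_symbol_boundary_eq_0:
  "s \<in> basis n \<Longrightarrow> frag_extend symbol_bd (symbol_bd s) = 0"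
proof (induction "snd s" arbitrary: s n rule: rev_induct)
  case Nil
  then show ?case by (simp add: symbol_boundary_def)
next
  case (snoc xs xss)
  define t where "t = (fst s, xss)"
  define k where "k = n - length xs"
  have s': "s = (fst s, xss @ [xs])" using snoc.hyps(2) by (simp add: prod_eq_iff)
  then have xs: "xs \<noteq> []" "group_seq xs" and t: "t \<in> basis k"
    using snoc.prems basis_snoc_iff[of "fst s" xss xs n] unfolding t_def k_def by metis+
  have s: "s = symbol_append t xs []" using s' xs(1) by (simp add: t_def symbol_append_def)
  have IH: "frag_extend symbol_bd (symbol_bd t) = 0"
    by (rule snoc.hyps(1)[OF _ t]) (simp add: t_def)
  have "frag_extend symbol_bd (symbol_bd s)
      = frag_cmul ((- 1) ^ (k - 1)) (frag_extend (factor_boundary xs) (symbol_bd t))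
      + frag_cmul ((- 1) ^ k) (frag_extend (factor_boundary xs) (symbol_bd t))"
    unfolding s symbol_boundary_append frag_extend_add frag_extend_cmul
      boundary_append_factor[OF keys_symbol_boundary[OF t]] IH boundary_factor_boundary[OF t xs(2)]
      total_length_basis[OF t]
    by (simp add: append_factor_def)
  also have "\<dots> = 0"
  proof (cases k)
    case 0
    \<comment> \<open>Here the signs agree, but a symbol of degree zero has no factors and hence no boundary.\<close>
    then have "xss = []"
      using basis_degree_pos[OF t[unfolded t_def]] by blast
    then show ?thesis by (simp add: t_def symbol_boundary_def)
  next
    case (Suc k')
    then show ?thesis by (simp flip: minus_frag_cmul)
  qed
  finally show ?case .
qed

end

section \<open>The chain complex\<close>

theorem proposition4p5:
  fixes L :: "'l set"
    and G :: "'l \<Rightarrow> ('a, 'm) monoid_scheme"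
    and rop :: "'l \<times> 'a \<Rightarrow> 'l \<times> 'a \<Rightarrow> 'l \<times> 'a"
    and Y :: "'y set"
    and act :: "'y \<Rightarrow> 'l \<times> 'a \<Rightarrow> 'y"
  assumes "multiple_group_rack L G rop"
    and "mgr_set L G rop Y act"
  shows "chain_complex (mgr_chain_group L G Y) (mgr_boundary G rop act)"
proof -
  interpret mgr_set L G rop Y act by (rule assms(2))
  have closed: "Poly_Mapping.keys (mgr_boundary G rop act n c) \<subseteq> mgr_basis L G Y (n - 1)"
    if c: "Poly_Mapping.keys c \<subseteq> mgr_basis L G Y n" for n c
  proof (cases "n \<le> 0")
    case False
    then have n: "int (nat n) = n" "int (nat n - 1) = n - 1" by auto
    have "Poly_Mapping.keys (symbol_bd s) \<subseteq> mgr_basis L G Y (n - 1)"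
      if "s \<in> Poly_Mapping.keys c" for s
      using keys_symbol_boundary[of s "nat n"] that c unfolding n by auto
    then show ?thesis
      using False keys_frag_extend[of symbol_bd c] by (fastforce simp: mgr_boundary_def)
  qed (simp add: mgr_boundary_def)
  have square: "mgr_boundary G rop act (n - 1) (mgr_boundary G rop act n c) = 0"
    if c: "Poly_Mapping.keys c \<subseteq> mgr_basis L G Y n" for n c
  proof (cases "n - 1 \<le> 0")
    case False
    then have n: "int (nat n) = n" by simp
    have "frag_extend symbol_bd (symbol_bd s) = 0" if "s \<in> Poly_Mapping.keys c" for s
      using boundary_symbol_boundary_eq_0[of s "nat n"] that c unfolding n by auto
    then show ?thesis
      using False by (simp add: mgr_boundary_def frag_extend_frag_extend frag_extend_eq_0)
  qed (simp add: mgr_boundary_def)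
  have "mgr_boundary G rop act n (a + b) = mgr_boundary G rop act n a + mgr_boundary G rop act n b"
    for n a b
    by (simp add: mgr_boundary_def frag_extend_add)
  then show ?thesis
    unfolding chain_complex_def mgr_chain_group_def
    by (auto simp: abelian_free_Abelian_group square intro!: homI dest: subsetD[OF closed])
qed

end
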